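(* Let $M\in\mathbb{N}$ and let $v_M(\mathbf{x},\omega)=\sum_{k=1}^{M}\lambda_k^{1/2}\phi_k(\mathbf{x})Y_k(\omega)$ be the truncated Karhunen-Loève expansion of a mean-zero random field in $L^2_{\mathbb{P}}(\Omega;L^2(U))$. Let $V_0=\operatorname{span}\{\phi_1,\dots,\phi_M\}$, let $(V_k)_{k\in\mathbb{N}_0}$, $(W_k)_{k\in\mathbb{N}_0}$ be a multilevel decomposition of $L^2(U)$ starting from $V_0$, and for each $l\in\mathbb{N}_0$ let $\psi^l_1,\dots,\psi^l_{M_l}$ be an orthonormal basis of $W_l$, $M_l=\dim W_l$. Suppose that $u(\mathbf{x},\omega)=v_M(\mathbf{x},\omega)+w(\mathbf{x},\omega)$ for some $w\in L^2_{\mathbb{P}}(\Omega;L^2(U))$ with $w(\cdot,\omega)\perp V_0$ almost surely, and let $$d^l_k(\omega)=\int_U u(\mathbf{x},\omega)\,\psi^l_k(\mathbf{x})\,d\mathbf{x},\qquad l\in\mathbb{N}_0,\ k=1,\dots,M_l.$$ Then, almost surely, $$\sum_{l\in\mathbb{N}_0}\sum_{k=1}^{M_l}(d^l_k)^2=\|w(\cdot,\omega)\|^2_{L^2(U)},$$ and $$\sum_{l\in\mathbb{N}_0}\sum_{k=1}^{M_l}\mathbb{E}[(d^l_k)^2]=\|w\|^2_{L^2_{\mathbb{P}}(\Omega;L^2(U))}.$$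
   Context: $(\Omega,\mathcal{F},\mathbb{P})$ is a complete probability space, $U$ is a domain in $\mathbb{R}^d$, and $L^2(U)$ is the real Hilbert space of square integrable functions $U\to\mathbb{R}$ with inner product $\langle u,v\rangle=\int_U uv\,d\mathbf{x}$. $L^2_{\mathbb{P}}(\Omega;L^2(U))$ is the (Bochner) space of functions $\Omega\to L^2(U)$ with inner product $\int_\Omega\langle u,v\rangle\,d\mathbb{P}$. $\mathbb{N}_0=\{0,1,2,\dots\}$. Karhunen-Loève expansion: for $v\in L^2_{\mathbb{P}}(\Omega;L^2(U))$ with $\mathbb{E}[v]=0$ and $\mathrm{Cov}(\mathbf{x},\mathbf{y})=\mathbb{E}[v(\mathbf{x},\omega)v(\mathbf{y},\omega)]$, one has $v=\sum_{k\in\mathbb{N}}\lambda_k^{1/2}\phi_kY_k$, where $\{\phi_k\}_{k\in\mathbb{N}}$ is an orthonormal set in $L^2(U)$ of eigenfunctions of $T(u)(\mathbf{x})=\int_U\mathrm{Cov}(\mathbf{x},\mathbf{y})u(\mathbf{y})\,d\mathbf{y}$ on $L^2(U)$ with eigenvalues $\lambda_1\ge\lambda_2\ge\cdots\ge0$, and the $Y_k$ are real random variables with $\mathbb{E}[Y_k]=0$ and $\mathbb{E}[Y_kY_l]=\delta_{kl}$. Multilevel decomposition: $V_0\subset V_1\subset\cdots\subset L^2(U)$ is a nested sequence of subspaces with $\overline{\bigcup_{k\in\mathbb{N}_0}V_k}=L^2(U)$ and $V_0=\operatorname{span}\{\phi_1,\dots,\phi_M\}$. The finite-dimensional subspaces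 $W_k\subset L^2(U)$, $k\in\mathbb{N}_0$, are defined by $V_{k+1}=V_k\oplus W_k$, where all direct sums are orthogonal, so that $\overline{V_0\oplus\bigoplus_{k\in\mathbb{N}_0}W_k}=L^2(U)$. *)

theory Defs
  imports "HOL-Probability.Probability"
begin

text \<open>
  Elements of \<open>L\<^sup>2(U)\<close> are represented by functions on the whole Euclidean space, of which only
  the values almost everywhere on \<open>U\<close> matter. Equality in \<open>L\<^sup>2(U)\<close> is therefore equality almost
  everywhere with respect to \<^term>\<open>lebesgue_on U\<close>, and every subspace below is closed under it.
\<close>

definition L2_fun :: "(real ^ 'n::finite) set \<Rightarrow> (real ^ 'n \<Rightarrow> real) set" where
  "L2_fun U = {f. f \<in> borel_measurable (lebesgue_on U) \<and> integrable (lebesgue_on U) (\<lambda>x. (f x)\<^sup>2)}"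

definition L2_inner ::
  "(real ^ 'n::finite) set \<Rightarrow> (real ^ 'n \<Rightarrow> real) \<Rightarrow> (real ^ 'n \<Rightarrow> real) \<Rightarrow> real" where
  "L2_inner U f g = (\<integral>x. f x * g x \<partial>lebesgue_on U)"

definition L2_norm :: "(real ^ 'n::finite) set \<Rightarrow> (real ^ 'n \<Rightarrow> real) \<Rightarrow> real" where
  "L2_norm U f = sqrt (L2_inner U f f)"

definition L2_closure ::
  "(real ^ 'n::finite) set \<Rightarrow> (real ^ 'n \<Rightarrow> real) set \<Rightarrow> (real ^ 'n \<Rightarrow> real) set" where
  "L2_closure U S = {f \<in> L2_fun U. \<forall>\<epsilon>>0. \<exists>g\<in>S. L2_norm U (\<lambda>x. f x - g x) < \<epsilon>}"

definition L2_subspace :: "(real ^ 'n::finite) set \<Rightarrow> (real ^ 'n \<Rightarrow> real) set \<Rightarrow> bool" where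
  "L2_subspace U V \<longleftrightarrow>
     V \<subseteq> L2_fun U \<and>
     (\<lambda>x. 0) \<in> V \<and>
     (\<forall>f\<in>V. \<forall>g\<in>V. (\<lambda>x. f x + g x) \<in> V) \<and>
     (\<forall>c. \<forall>f\<in>V. (\<lambda>x. c * f x) \<in> V) \<and>
     (\<forall>f\<in>V. \<forall>g\<in>L2_fun U. (AE x in lebesgue_on U. f x = g x) \<longrightarrow> g \<in> V)"

definition L2_span ::
  "(real ^ 'n::finite) set \<Rightarrow> nat \<Rightarrow> (nat \<Rightarrow> real ^ 'n \<Rightarrow> real) \<Rightarrow> (real ^ 'n \<Rightarrow> real) set" where
  "L2_span U n e =
     {f \<in> L2_fun U. \<exists>c. AE x in lebesgue_on U. f x = (\<Sum>k=1..n. c k * e k x)}"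

definition L2_finite_dim :: "(real ^ 'n::finite) set \<Rightarrow> (real ^ 'n \<Rightarrow> real) set \<Rightarrow> bool" where
  "L2_finite_dim U V \<longleftrightarrow> (\<exists>n e. (\<forall>k\<in>{1..n}. e k \<in> L2_fun U) \<and> V = L2_span U n e)"

text \<open>The dimension is the least length of a spanning family; meaningful for finite-dimensional
  subspaces only.\<close>

definition L2_dim :: "(real ^ 'n::finite) set \<Rightarrow> (real ^ 'n \<Rightarrow> real) set \<Rightarrow> nat" where
  "L2_dim U V = (LEAST n. \<exists>e. (\<forall>k\<in>{1..n}. e k \<in> L2_fun U) \<and> V = L2_span U n e)"

definition L2_orthonormal ::
  "(real ^ 'n::finite) set \<Rightarrow> nat set \<Rightarrow> (nat \<Rightarrow> real ^ 'n \<Rightarrow> real) \<Rightarrow> bool" where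
  "L2_orthonormal U K e \<longleftrightarrow>
     (\<forall>k\<in>K. e k \<in> L2_fun U) \<and>
     (\<forall>k\<in>K. \<forall>l\<in>K. L2_inner U (e k) (e l) = (if k = l then 1 else 0))"

definition L2_orthonormal_basis ::
  "(real ^ 'n::finite) set \<Rightarrow> (real ^ 'n \<Rightarrow> real) set \<Rightarrow> nat \<Rightarrow> (nat \<Rightarrow> real ^ 'n \<Rightarrow> real) \<Rightarrow> bool" where
  "L2_orthonormal_basis U V n e \<longleftrightarrow> L2_orthonormal U {1..n} e \<and> L2_span U n e = V"

definition L2_orthogonal_sum ::
  "(real ^ 'n::finite) set \<Rightarrow> (real ^ 'n \<Rightarrow> real) set \<Rightarrow> (real ^ 'n \<Rightarrow> real) set \<Rightarrow>
   (real ^ 'n \<Rightarrow> real) set \<Rightarrow> bool" where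
  "L2_orthogonal_sum U X V W \<longleftrightarrow>
     X = {(\<lambda>x. f x + g x) | f g. f \<in> V \<and> g \<in> W} \<and>
     (\<forall>f\<in>V. \<forall>g\<in>W. L2_inner U f g = 0)"

definition multilevel_decomposition ::
  "(real ^ 'n::finite) set \<Rightarrow> (nat \<Rightarrow> (real ^ 'n \<Rightarrow> real) set) \<Rightarrow>
   (nat \<Rightarrow> (real ^ 'n \<Rightarrow> real) set) \<Rightarrow> bool" where
  "multilevel_decomposition U V W \<longleftrightarrow>
     (\<forall>k. L2_subspace U (V k)) \<and>
     (\<forall>k. V k \<subseteq> V (Suc k)) \<and>
     L2_closure U (\<Union>k. V k) = L2_fun U \<and>
     (\<forall>k. L2_subspace U (W k) \<and> L2_finite_dim U (W k)) \<and>
     (\<forall>k. L2_orthogonal_sum U (V (Suc k)) (V k) (W k))"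

text \<open>
  A random field is written \<open>v \<omega> x\<close>. The Bochner integration of the library needs a Banach space
  type, whereas \<open>L\<^sup>2(U)\<close> depends on \<open>U\<close>; the Bochner space of square integrable functions from
  \<open>P\<close> to \<open>L\<^sup>2(U)\<close> is therefore spelled out: strongly measurable functions, that is, almost sure
  limits in \<open>L\<^sup>2(U)\<close> of \<open>L\<^sup>2(U)\<close>-valued simple functions, whose norm is square integrable.
\<close>

definition L2_strongly_measurable ::
  "'w measure \<Rightarrow> (real ^ 'n::finite) set \<Rightarrow> ('w \<Rightarrow> real ^ 'n \<Rightarrow> real) \<Rightarrow> bool" where
  "L2_strongly_measurable P U v \<longleftrightarrow>
     (AE \<omega> in P. v \<omega> \<in> L2_fun U) \<and>
     (\<exists>s. (\<forall>n. simple_function P (s n) \<and> s n ` space P \<subseteq> L2_fun U) \<and>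
          (AE \<omega> in P. (\<lambda>n. L2_norm U (\<lambda>x. v \<omega> x - s n \<omega> x)) \<longlonglongrightarrow> 0))"

definition bochner_L2 ::
  "'w measure \<Rightarrow> (real ^ 'n::finite) set \<Rightarrow> ('w \<Rightarrow> real ^ 'n \<Rightarrow> real) set" where
  "bochner_L2 P U =
     {v. L2_strongly_measurable P U v \<and> integrable P (\<lambda>\<omega>. (L2_norm U (v \<omega>))\<^sup>2)}"

definition bochner_L2_inner ::
  "'w measure \<Rightarrow> (real ^ 'n::finite) set \<Rightarrow> ('w \<Rightarrow> real ^ 'n \<Rightarrow> real) \<Rightarrow>
   ('w \<Rightarrow> real ^ 'n \<Rightarrow> real) \<Rightarrow> real" where
  "bochner_L2_inner P U v w = (\<integral>\<omega>. L2_inner U (v \<omega>) (w \<omega>) \<partial>P)"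

definition bochner_L2_norm ::
  "'w measure \<Rightarrow> (real ^ 'n::finite) set \<Rightarrow> ('w \<Rightarrow> real ^ 'n \<Rightarrow> real) \<Rightarrow> real" where
  "bochner_L2_norm P U v = sqrt (bochner_L2_inner P U v v)"

definition Cov :: "'w measure \<Rightarrow> ('w \<Rightarrow> 'x \<Rightarrow> real) \<Rightarrow> 'x \<Rightarrow> 'x \<Rightarrow> real" where
  "Cov P v x y = (\<integral>\<omega>. v \<omega> x * v \<omega> y \<partial>P)"

definition cov_operator ::
  "'w measure \<Rightarrow> (real ^ 'n::finite) set \<Rightarrow> ('w \<Rightarrow> real ^ 'n \<Rightarrow> real) \<Rightarrow>
   (real ^ 'n \<Rightarrow> real) \<Rightarrow> real ^ 'n \<Rightarrow> real" where
  "cov_operator P U v f x = (\<integral>y. Cov P v x y * f y \<partial>lebesgue_on U)"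

definition KL_truncation ::
  "nat \<Rightarrow> (nat \<Rightarrow> real) \<Rightarrow> (nat \<Rightarrow> 'x \<Rightarrow> real) \<Rightarrow> (nat \<Rightarrow> 'w \<Rightarrow> real) \<Rightarrow> 'w \<Rightarrow> 'x \<Rightarrow> real" where
  "KL_truncation n lam \<phi> Y \<omega> x = (\<Sum>k=1..n. sqrt (lam k) * \<phi> k x * Y k \<omega>)"

text \<open>
  The index \<open>k\<close> runs from 1; values at \<open>k = 0\<close> are irrelevant. Joint measurability selects a
  representative of the Bochner class of \<open>v\<close> for which the pointwise expectations \<open>E[v(x)]\<close> and
  \<open>E[v(x) v(y)]\<close> make sense for almost all \<open>x\<close>, \<open>y\<close>.
\<close>

definition KL_expansion ::
  "'w measure \<Rightarrow> (real ^ 'n::finite) set \<Rightarrow> ('w \<Rightarrow> real ^ 'n \<Rightarrow> real) \<Rightarrow>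
   (nat \<Rightarrow> real) \<Rightarrow> (nat \<Rightarrow> real ^ 'n \<Rightarrow> real) \<Rightarrow> (nat \<Rightarrow> 'w \<Rightarrow> real) \<Rightarrow> bool" where
  "KL_expansion P U v lam \<phi> Y \<longleftrightarrow>
     v \<in> bochner_L2 P U \<and>
     case_prod v \<in> borel_measurable (P \<Otimes>\<^sub>M lebesgue_on U) \<and>
     (AE x in lebesgue_on U. (\<integral>\<omega>. v \<omega> x \<partial>P) = 0) \<and>
     L2_orthonormal U {1..} \<phi> \<and>
     (\<forall>k\<ge>1. AE x in lebesgue_on U. cov_operator P U v (\<phi> k) x = lam k * \<phi> k x) \<and>
     (\<forall>k\<ge>1. lam k \<ge> lam (Suc k) \<and> lam k \<ge> 0) \<and>
     (\<forall>k\<ge>1. Y k \<in> borel_measurable P \<and> integrable P (\<lambda>\<omega>. (Y k \<omega>)\<^sup>2) \<and> (\<integral>\<omega>. Y k \<omega> \<partial>P) = 0) \<and>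
     (\<forall>k\<ge>1. \<forall>l\<ge>1. (\<integral>\<omega>. Y k \<omega> * Y l \<omega> \<partial>P) = (if k = l then 1 else 0)) \<and>
     (\<lambda>n. bochner_L2_norm P U (\<lambda>\<omega> x. v \<omega> x - KL_truncation n lam \<phi> Y \<omega> x)) \<longlonglongrightarrow> 0"

end

theory Submission
  imports Defs
begin

text \<open>
  By induction on \<open>N\<close>, \<open>V\<^sub>N\<close> contains the orthogonal projection \<open>p\<^sub>N\<close> of a function \<open>g \<perp> V\<^sub>0\<close>, and
  the square of its norm is the sum of the squared coefficients of \<open>g\<close> over the levels below \<open>N\<close>.
  Hence \<open>g\<close> minus any element of \<open>V\<^sub>N\<close> has squared norm at least \<open>\<parallel>g\<parallel>\<^sup>2\<close> minus that sum, and density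
  of \<open>\<Union>V\<^sub>N\<close> gives Parseval's identity. Applied to almost every \<open>w(\<omega>)\<close> this is the first claim,
  since the truncated expansion lies in \<open>V\<^sub>0\<close> and so does not contribute to the coefficients. The
  second claim follows by dominated convergence, with \<open>\<parallel>w(\<omega>)\<parallel>\<^sup>2\<close> as the dominating function.
\<close>

section \<open>Complete measures\<close>

text \<open>The preimages under \<open>f\<close> and \<open>g\<close> differ only inside a null set,
  and completeness makes every such difference measurable. The last hypothesis controls
  \<open>g\<close> on the null set, where the almost everywhere equality says nothing.\<close>

lemma (in complete_measure) measurable_cong_AE_complete:
  assumes f: "f \<in> measurable M N" and eq: "AE x in M. f x = g x"
    and g: "\<And>x. x \<in> space M \<Longrightarrow> g x \<in> space N"
  shows "g \<in> measurable M N"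
proof (rule measurableI)
  fix A assume A: "A \<in> sets N"
  show "g -` A \<inter> space M \<in> sets M"
  proof (rule in_sets_AE)
    show "AE x in M. x \<in> f -` A \<inter> space M \<longleftrightarrow> x \<in> g -` A \<inter> space M"
      using eq by eventually_elim auto
  qed (use measurable_sets[OF f A] in auto)
qed (rule g)

text \<open>Null sets of the restriction are Lebesgue null sets contained in \<open>U\<close>, so
  completeness is inherited from Lebesgue measure.\<close>

lemma complete_measure_lebesgue_on:
  assumes "U \<in> sets lebesgue"
  shows "complete_measure (lebesgue_on U)"
proof
  fix A B :: "'a set"
  assume "B \<subseteq> A" "A \<in> null_sets (lebesgue_on U)"
  then have "A \<in> null_sets lebesgue" "A \<subseteq> U"
    using assms by (auto simp: null_sets_restrict_space)
  then have "B \<in> null_sets lebesgue"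
    using \<open>B \<subseteq> A\<close> completion.complete2 by blast
  then show "B \<in> sets (lebesgue_on U)"
    using assms \<open>B \<subseteq> A\<close> \<open>A \<subseteq> U\<close> by (auto simp: sets_restrict_space_iff)
qed

section \<open>The inner product of square integrable functions\<close>

lemma L2_fun_measurable:
  "f \<in> L2_fun U \<Longrightarrow> f \<in> borel_measurable (lebesgue_on U)"
  by (simp add: L2_fun_def)

text \<open>The product is dominated by the sum of the squares, by expanding
  \<open>(\<bar>f x\<bar> - \<bar>g x\<bar>)\<^sup>2 \<ge> 0\<close>. Thus \<open>L2_inner\<close>
  is a genuine integral on \<open>L2_fun U\<close>, never the default value 0, which makes it
  bilinear there.\<close>

lemma L2_fun_integrable_mult:
  assumes "f \<in> L2_fun U" "g \<in> L2_fun U"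
  shows "integrable (lebesgue_on U) (\<lambda>x. f x * g x)"
proof (rule Bochner_Integration.integrable_bound)
  show "integrable (lebesgue_on U) (\<lambda>x. (f x)\<^sup>2 + (g x)\<^sup>2)"
    using assms by (simp add: L2_fun_def)
  show "(\<lambda>x. f x * g x) \<in> borel_measurable (lebesgue_on U)"
    using assms by (intro borel_measurable_times L2_fun_measurable)
  have "norm (f x * g x) \<le> norm ((f x)\<^sup>2 + (g x)\<^sup>2)" for x
  proof -
    have "0 \<le> (\<bar>f x\<bar> - \<bar>g x\<bar>)\<^sup>2"
      by simp
    then have "2 * (\<bar>f x\<bar> * \<bar>g x\<bar>) \<le> (f x)\<^sup>2 + (g x)\<^sup>2"
      by (simp add: power2_diff)
    moreover have "0 \<le> \<bar>f x\<bar> * \<bar>g x\<bar>"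
      by simp
    ultimately show ?thesis
      unfolding real_norm_def abs_mult by linarith
  qed
  then show "AE x in lebesgue_on U. norm (f x * g x) \<le> norm ((f x)\<^sup>2 + (g x)\<^sup>2)"
    by simp
qed

lemma L2_fun_cmult:
  assumes "f \<in> L2_fun U"
  shows "(\<lambda>x. c * f x) \<in> L2_fun U"
  using assms by (auto simp: L2_fun_def power_mult_distrib intro!: borel_measurable_times)

lemma L2_fun_add:
  assumes "f \<in> L2_fun U" "g \<in> L2_fun U"
  shows "(\<lambda>x. f x + g x) \<in> L2_fun U"
proof -
  have "integrable (lebesgue_on U) (\<lambda>x. (f x)\<^sup>2 + (g x)\<^sup>2 + 2 * (f x * g x))"
    using assms L2_fun_integrable_mult[OF assms] by (simp add: L2_fun_def)
  then show ?thesis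
    using assms by (auto simp: L2_fun_def power2_sum mult.assoc intro!: borel_measurable_add)
qed

lemma L2_fun_diff:
  assumes "f \<in> L2_fun U" "g \<in> L2_fun U"
  shows "(\<lambda>x. f x - g x) \<in> L2_fun U"
  using L2_fun_add[OF assms(1) L2_fun_cmult[OF assms(2), of "-1"]] by simp

lemma L2_fun_sum:
  assumes "\<And>i. i \<in> I \<Longrightarrow> f i \<in> L2_fun U"
  shows "(\<lambda>x. \<Sum>i\<in>I. f i x) \<in> L2_fun U"
  using assms
proof (induction I rule: infinite_finite_induct)
  case (insert i I)
  then show ?case
    by (simp add: L2_fun_add)
qed (simp_all add: L2_fun_def)

lemma L2_inner_commute: "L2_inner U f g = L2_inner U g f"
  by (simp add: L2_inner_def mult.commute)

lemma L2_inner_self_nonneg: "0 \<le> L2_inner U f f"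
  by (simp add: L2_inner_def)

lemma L2_norm_squared: "(L2_norm U f)\<^sup>2 = L2_inner U f f"
  by (simp add: L2_norm_def L2_inner_self_nonneg)

lemma L2_inner_add_left:
  assumes "f \<in> L2_fun U" "g \<in> L2_fun U" "h \<in> L2_fun U"
  shows "L2_inner U (\<lambda>x. f x + g x) h = L2_inner U f h + L2_inner U g h"
  using assms by (simp add: L2_inner_def distrib_right L2_fun_integrable_mult)

lemma L2_inner_diff_left:
  assumes "f \<in> L2_fun U" "g \<in> L2_fun U" "h \<in> L2_fun U"
  shows "L2_inner U (\<lambda>x. f x - g x) h = L2_inner U f h - L2_inner U g h"
  using assms by (simp add: L2_inner_def left_diff_distrib L2_fun_integrable_mult)

lemma L2_inner_add_right:
  assumes "f \<in> L2_fun U" "g \<in> L2_fun U" "h \<in> L2_fun U"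
  shows "L2_inner U h (\<lambda>x. f x + g x) = L2_inner U h f + L2_inner U h g"
  using L2_inner_add_left[OF assms] by (simp add: L2_inner_commute)

lemma L2_inner_diff_right:
  assumes "f \<in> L2_fun U" "g \<in> L2_fun U" "h \<in> L2_fun U"
  shows "L2_inner U h (\<lambda>x. f x - g x) = L2_inner U h f - L2_inner U h g"
  using L2_inner_diff_left[OF assms] by (simp add: L2_inner_commute)

lemma L2_inner_sum_right:
  assumes "\<And>i. i \<in> I \<Longrightarrow> f i \<in> L2_fun U" "g \<in> L2_fun U"
  shows "L2_inner U g (\<lambda>x. \<Sum>i\<in>I. c i * f i x) = (\<Sum>i\<in>I. c i * L2_inner U g (f i))"
proof -
  have "L2_inner U g (\<lambda>x. \<Sum>i\<in>I. c i * f i x) = (\<integral>x. (\<Sum>i\<in>I. c i * (g x * f i x)) \<partial>lebesgue_on U)"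
    by (simp add: L2_inner_def sum_distrib_left mult.left_commute)
  also have "\<dots> = (\<Sum>i\<in>I. c i * L2_inner U g (f i))"
    using assms by (subst Bochner_Integration.integral_sum)
      (auto simp: L2_inner_def intro!: L2_fun_integrable_mult)
  finally show ?thesis .
qed

text \<open>The function \<open>g\<close> is only known up to a null set; its measurability comes
  from completeness of \<open>lebesgue_on U\<close>. This serves for representatives such as
  \<open>u \<omega>\<close>, given only by an almost everywhere identity.\<close>

lemma L2_inner_cong_AE:
  assumes "open U" "f \<in> L2_fun U" "h \<in> L2_fun U" "AE x in lebesgue_on U. g x = f x"
  shows "L2_inner U g h = L2_inner U f h"
proof -
  have "complete_measure (lebesgue_on U)"
    using \<open>open U\<close> by (simp add: complete_measure_lebesgue_on)
  then have g: "g \<in> borel_measurable (lebesgue_on U)"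
  proof (rule complete_measure.measurable_cong_AE_complete)
    show "f \<in> borel_measurable (lebesgue_on U)"
      using assms(2) by (rule L2_fun_measurable)
    show "AE x in lebesgue_on U. f x = g x"
      using assms(4) by eventually_elim simp
  qed simp
  show ?thesis
    unfolding L2_inner_def
  proof (rule integral_cong_AE)
    show "(\<lambda>x. g x * h x) \<in> borel_measurable (lebesgue_on U)"
      using g L2_fun_measurable[OF assms(3)] by (rule borel_measurable_times)
    show "(\<lambda>x. f x * h x) \<in> borel_measurable (lebesgue_on U)"
      using assms by (intro borel_measurable_times L2_fun_measurable)
    show "AE x in lebesgue_on U. g x * h x = f x * h x"
      using assms(4) by eventually_elim simp
  qed
qed

section \<open>Finite spans and the Cauchy-Schwarz inequality for unit vectors\<close>

lemma L2_span_sum: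
  assumes "\<And>k. k \<in> {1..n} \<Longrightarrow> e k \<in> L2_fun U"
  shows "(\<lambda>x. \<Sum>k=1..n. c k * e k x) \<in> L2_span U n e"
  unfolding L2_span_def using assms by (auto intro!: L2_fun_sum L2_fun_cmult)

lemma L2_span_generator:
  assumes "\<And>k. k \<in> {1..n} \<Longrightarrow> e k \<in> L2_fun U" "j \<in> {1..n}"
  shows "e j \<in> L2_span U n e"
proof -
  have "(\<lambda>x. \<Sum>k=1..n. (if k = j then 1 else 0) * e k x) = e j"
    using assms(2) by (simp add: if_distrib[of "\<lambda>c. c * _"] cong: if_cong)
  then show ?thesis
    using L2_span_sum[of n e U "\<lambda>k. if k = j then 1 else 0"] assms(1) by simp
qed

text \<open>With \<open>c = L2_inner U f e\<close>, the squared distance from \<open>f\<close> to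
  its projection \<open>c * e\<close> is \<open>L2_inner U f f - c\<^sup>2\<close>, and it is
  nonnegative.\<close>

lemma L2_inner_le_norm_unit:
  assumes "f \<in> L2_fun U" "e \<in> L2_fun U" "L2_inner U e e = 1"
  shows "\<bar>L2_inner U f e\<bar> \<le> L2_norm U f"
proof -
  define c where "c = L2_inner U f e"
  define h where "h = (\<lambda>x. c * e x)"
  have h: "h \<in> L2_fun U"
    unfolding h_def using assms(2) by (rule L2_fun_cmult)
  have inner_h: "L2_inner U k h = c * L2_inner U k e" for k
    by (simp add: L2_inner_def h_def mult.left_commute)
  have "0 \<le> L2_inner U (\<lambda>x. f x - h x) (\<lambda>x. f x - h x)"
    by (rule L2_inner_self_nonneg)
  also have "\<dots> = L2_inner U f f - c\<^sup>2"
    using assms h inner_h[of h] inner_h[of f] inner_h[of e]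
    by (simp add: L2_inner_diff_left L2_inner_diff_right L2_fun_diff L2_inner_commute[of U h f]
        L2_inner_commute[of U h e] c_def power2_eq_square)
  finally have "c\<^sup>2 \<le> (L2_norm U f)\<^sup>2"
    by (simp add: L2_norm_squared)
  then show ?thesis
    unfolding c_def using L2_inner_self_nonneg[of U f]
    by (intro power2_le_imp_le[of "\<bar>L2_inner U f e\<bar>"]) (simp_all add: L2_norm_def)
qed

section \<open>Parseval's identity for a multilevel decomposition\<close>

lemma multilevel_decomposition_mono:
  assumes "multilevel_decomposition U V W" "k \<le> l"
  shows "V k \<subseteq> V l"
  using assms lift_Suc_mono_le[of V k l] by (simp add: multilevel_decomposition_def)

text \<open>The first conjunct expresses that \<open>g - p\<close> is orthogonal to
  \<open>V N\<close>. The projection is built level by level from finite sums of basis functions, so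
  its existence does not rest on completeness of the Hilbert space.\<close>

lemma multilevel_projection:
  assumes "open U" and ml: "multilevel_decomposition U V W"
    and onb: "\<And>l. L2_orthonormal_basis U (W l) (m l) (\<psi> l)"
    and g: "g \<in> L2_fun U" and perp: "\<And>f. f \<in> V 0 \<Longrightarrow> L2_inner U g f = 0"
  shows "\<exists>p\<in>V N. (\<forall>f\<in>V N. L2_inner U g f = L2_inner U p f) \<and>
           L2_inner U p p = (\<Sum>l<N. \<Sum>k=1..m l. (L2_inner U g (\<psi> l k))\<^sup>2)"
proof (induction N)
  case 0
  \<comment> \<open>As \<open>g\<close> is orthogonal to \<open>V 0\<close>, its projection there is
    zero, matching the empty sum.\<close>
  have "(\<lambda>x. 0) \<in> V 0"
    using ml by (simp add: multilevel_decomposition_def L2_subspace_def)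
  then show ?case
    by (rule bexI[rotated]) (simp add: perp, simp add: L2_inner_def)
next
  case (Suc N)
  then obtain p where p: "p \<in> V N" "\<And>f. f \<in> V N \<Longrightarrow> L2_inner U g f = L2_inner U p f"
      "L2_inner U p p = (\<Sum>l<N. \<Sum>k=1..m l. (L2_inner U g (\<psi> l k))\<^sup>2)"
    by auto
  \<comment> \<open>The function \<open>q\<close> is the orthogonal projection of \<open>g\<close>
    onto \<open>W N\<close>, with the coefficients of \<open>g\<close> in the orthonormal
    basis.\<close>
  define c where "c k = L2_inner U g (\<psi> N k)" for k
  define q where "q = (\<lambda>x. \<Sum>k=1..m N. c k * \<psi> N k x)"
  have VN: "f \<in> L2_fun U" if "f \<in> V N" for f
    using ml that by (auto simp: multilevel_decomposition_def L2_subspace_def)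
  have WN: "f \<in> L2_fun U" if "f \<in> W N" for f
    using ml that by (auto simp: multilevel_decomposition_def L2_subspace_def)
  have Suc_eq: "V (Suc N) = {(\<lambda>x. f x + h x) | f h. f \<in> V N \<and> h \<in> W N}"
    and orth: "\<And>f h. f \<in> V N \<Longrightarrow> h \<in> W N \<Longrightarrow> L2_inner U f h = 0"
    using ml unfolding multilevel_decomposition_def L2_orthogonal_sum_def by blast+
  have psi: "\<psi> N k \<in> L2_fun U" if "k \<in> {1..m N}" for k
    using onb[of N] that by (auto simp: L2_orthonormal_basis_def L2_orthonormal_def)
  have psi_on: "L2_inner U (\<psi> N j) (\<psi> N k) = (if j = k then 1 else 0)"
    if "j \<in> {1..m N}" "k \<in> {1..m N}" for j k
    using onb[of N] that unfolding L2_orthonormal_basis_def L2_orthonormal_def by blast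
  have W_eq: "L2_span U (m N) (\<psi> N) = W N"
    using onb[of N] by (simp add: L2_orthonormal_basis_def)
  have q: "q \<in> W N"
    unfolding q_def W_eq[symmetric] by (rule L2_span_sum[OF psi])
  have inner_q_psi: "L2_inner U q (\<psi> N k) = c k" if "k \<in> {1..m N}" for k
  proof -
    have "L2_inner U (\<psi> N k) q = (\<Sum>j=1..m N. c j * L2_inner U (\<psi> N k) (\<psi> N j))"
      unfolding q_def using psi that by (intro L2_inner_sum_right) auto
    also have "\<dots> = (\<Sum>j=1..m N. if k = j then c j else 0)"
      using psi_on that by (intro sum.cong) auto
    also have "\<dots> = c k"
      using that by simp
    finally show ?thesis
      by (simp add: L2_inner_commute)
  qed
  have inner_W: "L2_inner U g h = L2_inner U q h" if "h \<in> W N" for h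
  proof -
    have "\<exists>b. AE x in lebesgue_on U. h x = (\<Sum>k=1..m N. b k * \<psi> N k x)"
      using that unfolding W_eq[symmetric] L2_span_def by simp
    then obtain b where b: "AE x in lebesgue_on U. h x = (\<Sum>k=1..m N. b k * \<psi> N k x)" ..
    \<comment> \<open>Stated for general \<open>f\<close> so as to apply to both \<open>g\<close>
      and \<open>q\<close>, whose inner products with each basis function agree.\<close>
    have expand: "L2_inner U f h = (\<Sum>k=1..m N. b k * L2_inner U f (\<psi> N k))" if "f \<in> L2_fun U" for f
    proof -
      have "L2_inner U h f = L2_inner U (\<lambda>x. \<Sum>k=1..m N. b k * \<psi> N k x) f"
        using b psi that \<open>open U\<close> by (intro L2_inner_cong_AE L2_fun_sum L2_fun_cmult) auto
      then show ?thesis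
        using L2_inner_sum_right[of "{1..m N}" "\<psi> N" U f b] psi that by (simp add: L2_inner_commute)
    qed
    show ?thesis
      using inner_q_psi by (simp add: expand g q WN c_def)
  qed
  have inner_q: "L2_inner U q q = (\<Sum>k=1..m N. (c k)\<^sup>2)"
  proof -
    have "L2_inner U q q = (\<Sum>k=1..m N. c k * L2_inner U q (\<psi> N k))"
      using L2_inner_sum_right[of "{1..m N}" "\<psi> N" U q c] psi WN[OF q] by (simp add: q_def)
    then show ?thesis
      using inner_q_psi by (simp add: power2_eq_square)
  qed
  \<comment> \<open>The new projection is \<open>p + q\<close>. Orthogonality of \<open>V N\<close>
    and \<open>W N\<close> removes the mixed terms, both when testing against \<open>a + b\<close>
    and in the squared norm.\<close>
  show ?case
  proof (intro bexI conjI ballI)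
    show "(\<lambda>x. p x + q x) \<in> V (Suc N)"
      using p q by (auto simp: Suc_eq)
    show "L2_inner U g f = L2_inner U (\<lambda>x. p x + q x) f" if "f \<in> V (Suc N)" for f
    proof -
      obtain a b where f: "f = (\<lambda>x. a x + b x)" and a: "a \<in> V N" and b: "b \<in> W N"
        using \<open>f \<in> V (Suc N)\<close> Suc_eq by blast
      have "L2_inner U p b = 0" "L2_inner U q a = 0"
        using orth p a b q by (simp_all add: L2_inner_commute[of U q a])
      then show ?thesis
        using p(2)[OF a] inner_W[OF b]
        by (simp add: f L2_inner_add_left L2_inner_add_right L2_fun_add g VN[OF a] VN[OF p(1)]
            WN[OF b] WN[OF q])
    qed
    show "L2_inner U (\<lambda>x. p x + q x) (\<lambda>x. p x + q x) =
        (\<Sum>l<Suc N. \<Sum>k=1..m l. (L2_inner U g (\<psi> l k))\<^sup>2)"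
      using p(3) inner_q orth[OF p(1) q]
      by (simp add: L2_inner_add_left L2_inner_add_right L2_fun_add VN[OF p(1)] WN[OF q]
          L2_inner_commute[of U q p] c_def)
  qed
qed

lemma multilevel_parseval:
  assumes "open U" and ml: "multilevel_decomposition U V W"
    and "\<And>l. L2_orthonormal_basis U (W l) (m l) (\<psi> l)"
    and g: "g \<in> L2_fun U" and "\<And>f. f \<in> V 0 \<Longrightarrow> L2_inner U g f = 0"
  shows "(\<lambda>l. \<Sum>k=1..m l. (L2_inner U g (\<psi> l k))\<^sup>2) sums (L2_norm U g)\<^sup>2"
proof -
  define S where "S N = (\<Sum>l<N. \<Sum>k=1..m l. (L2_inner U g (\<psi> l k))\<^sup>2)" for N
  have VN: "f \<in> L2_fun U" if "f \<in> V N" for f N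
    using ml that by (auto simp: multilevel_decomposition_def L2_subspace_def)
  \<comment> \<open>Bessel's inequality and best approximation. Both \<open>p\<close> and
    \<open>p - h\<close> lie in \<open>V N\<close>, to which \<open>g - p\<close> is orthogonal, so
    Pythagoras applies to \<open>g = (g - p) + p\<close> and to
    \<open>g - h = (g - p) + (p - h)\<close>.\<close>
  have dist: "S N \<le> (L2_norm U g)\<^sup>2 \<and> (L2_norm U g)\<^sup>2 - S N \<le> (L2_norm U (\<lambda>x. g x - h x))\<^sup>2"
    if h: "h \<in> V N" for h N
  proof -
    obtain p where p: "p \<in> V N" "\<And>f. f \<in> V N \<Longrightarrow> L2_inner U g f = L2_inner U p f"
      "L2_inner U p p = S N"
      using multilevel_projection[OF assms] unfolding S_def by blast
    have p': "p \<in> L2_fun U" and h': "h \<in> L2_fun U"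
      using p(1) h VN by auto
    have gp: "L2_inner U g p = S N"
      using p by simp
    have "0 \<le> L2_inner U (\<lambda>x. g x - p x) (\<lambda>x. g x - p x)"
      by (rule L2_inner_self_nonneg)
    also have "\<dots> = L2_inner U g g - S N"
      using p p' g gp
      by (simp add: L2_inner_diff_left L2_inner_diff_right L2_fun_diff L2_inner_commute[of U p g])
    finally have "S N \<le> L2_inner U g g"
      by simp
    moreover have "L2_inner U (\<lambda>x. g x - h x) (\<lambda>x. g x - h x) =
        L2_inner U g g - S N + L2_inner U (\<lambda>x. p x - h x) (\<lambda>x. p x - h x)"
      using p p' g h h' gp
      by (simp add: L2_inner_diff_left L2_inner_diff_right L2_fun_diff L2_inner_commute[of U h g]
        L2_inner_commute[of U h p])
    moreover have "0 \<le> L2_inner U (\<lambda>x. p x - h x) (\<lambda>x. p x - h x)"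
      by (rule L2_inner_self_nonneg)
    ultimately show ?thesis
      by (simp add: L2_norm_squared)
  qed
  have zero: "(\<lambda>x. 0) \<in> V N" for N
    using ml by (simp add: multilevel_decomposition_def L2_subspace_def)
  have "S \<longlonglongrightarrow> (L2_norm U g)\<^sup>2"
  proof (rule LIMSEQ_I)
    fix r :: real assume "0 < r"
    have "g \<in> L2_closure U (\<Union>k. V k)"
      using ml g by (simp add: multilevel_decomposition_def)
    \<comment> \<open>The tolerance is \<open>sqrt r\<close> because \<open>dist\<close> bounds the
      error by a squared norm. By nestedness the same \<open>h\<close> serves every
      \<open>N \<ge> K\<close>.\<close>
    then obtain h K where h: "h \<in> V K" "L2_norm U (\<lambda>x. g x - h x) < sqrt r"
      using \<open>0 < r\<close> by (auto simp: L2_closure_def dest!: spec[of _ "sqrt r"])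
    have "(L2_norm U (\<lambda>x. g x - h x))\<^sup>2 < r"
      using power_strict_mono[OF h(2), of 2] \<open>0 < r\<close> by (simp add: L2_norm_def L2_inner_self_nonneg)
    moreover have "h \<in> V N" if "K \<le> N" for N
      using multilevel_decomposition_mono[OF ml that] h by auto
    ultimately have "norm (S N - (L2_norm U g)\<^sup>2) < r" if "K \<le> N" for N
      using dist[of h N] that by fastforce
    then show "\<exists>no. \<forall>n\<ge>no. norm (S n - (L2_norm U g)\<^sup>2) < r"
      by blast
  qed
  then show ?thesis
    by (simp add: sums_def S_def[abs_def])
qed

section \<open>Measurability of the coefficients of a random field\<close>

text \<open>The inner product with \<open>e\<close> turns the approximating simple functions into
  real simple functions, and it is 1-Lipschitz, so these converge almost surely to the claimed
  function. Completeness of \<open>P\<close> handles the exceptional set.\<close>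

lemma L2_strongly_measurable_inner_unit:
  assumes "complete_measure P" and w: "L2_strongly_measurable P U w"
    and e: "e \<in> L2_fun U" "L2_inner U e e = 1"
  shows "(\<lambda>\<omega>. L2_inner U (w \<omega>) e) \<in> borel_measurable P"
proof -
  obtain s where s: "\<And>n. simple_function P (s n)" "\<And>n. s n ` space P \<subseteq> L2_fun U"
    and lim: "AE \<omega> in P. (\<lambda>n. L2_norm U (\<lambda>x. w \<omega> x - s n \<omega> x)) \<longlonglongrightarrow> 0"
    using w unfolding L2_strongly_measurable_def by blast
  have meas: "(\<lambda>\<omega>. L2_inner U (s n \<omega>) e) \<in> borel_measurable P" for n
    using simple_function_compose[OF s(1), of "\<lambda>f. L2_inner U f e"]
    by (intro borel_measurable_simple_function) (simp add: comp_def)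
  have w_L2: "AE \<omega> in P. w \<omega> \<in> L2_fun U"
    using w by (simp add: L2_strongly_measurable_def)
  \<comment> \<open>Measurability of \<open>lim\<close> holds even where the sequence diverges and
    the value is unspecified; convergence is only almost sure.\<close>
  have "(\<lambda>\<omega>. lim (\<lambda>n. L2_inner U (s n \<omega>) e)) \<in> borel_measurable P"
    using meas by (rule borel_measurable_lim_metric)
  moreover have "AE \<omega> in P. lim (\<lambda>n. L2_inner U (s n \<omega>) e) = L2_inner U (w \<omega>) e"
    using lim w_L2 AE_space
  proof eventually_elim
    case (elim \<omega>)
    have sn: "s n \<omega> \<in> L2_fun U" for n
      using s(2) elim(3) by blast
    have "norm (L2_inner U (s n \<omega>) e - L2_inner U (w \<omega>) e) \<le> L2_norm U (\<lambda>x. w \<omega> x - s n \<omega> x)" for n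
      using L2_inner_le_norm_unit[OF L2_fun_diff[OF elim(2) sn[of n]] e]
      by (simp add: L2_inner_diff_left[OF elim(2) sn e(1)] abs_minus_commute)
    then have "(\<lambda>n. L2_inner U (s n \<omega>) e - L2_inner U (w \<omega>) e) \<longlonglongrightarrow> 0"
      by (intro Lim_null_comparison[OF _ elim(1)]) simp
    then show ?case
      by (intro limI) (simp add: LIM_zero_iff)
  qed
  ultimately show ?thesis
    by (rule complete_measure.measurable_cong_AE_complete[OF assms(1)]) simp
qed

section \<open>Coefficients of a truncated expansion plus an orthogonal remainder\<close>

theorem theorem3p2:
  fixes P :: "'w measure"
    and U :: "(real ^ 'n::finite) set"
    and v u w :: "'w \<Rightarrow> real ^ 'n \<Rightarrow> real"
    and lam :: "nat \<Rightarrow> real"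
    and \<phi> :: "nat \<Rightarrow> real ^ 'n \<Rightarrow> real"
    and Y :: "nat \<Rightarrow> 'w \<Rightarrow> real"
    and M :: nat
    and V W :: "nat \<Rightarrow> (real ^ 'n \<Rightarrow> real) set"
    and m :: "nat \<Rightarrow> nat"
    and \<psi> :: "nat \<Rightarrow> nat \<Rightarrow> real ^ 'n \<Rightarrow> real"
    and d :: "nat \<Rightarrow> nat \<Rightarrow> 'w \<Rightarrow> real"
  assumes "prob_space P" and "complete_measure P"
    and "open U" and "connected U" and "U \<noteq> {}"
    and "M \<ge> 1"
    and "KL_expansion P U v lam \<phi> Y"
    and "multilevel_decomposition U V W"
    and "V 0 = L2_span U M \<phi>"
    and "\<And>l. m l = L2_dim U (W l)"
    and "\<And>l. L2_orthonormal_basis U (W l) (m l) (\<psi> l)"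
    and "w \<in> bochner_L2 P U"
    and "AE \<omega> in P. \<forall>f\<in>V 0. L2_inner U (w \<omega>) f = 0"
    and "AE \<omega> in P. AE x in lebesgue_on U. u \<omega> x = KL_truncation M lam \<phi> Y \<omega> x + w \<omega> x"
    and "\<And>l k \<omega>. d l k \<omega> = (\<integral>x. u \<omega> x * \<psi> l k x \<partial>lebesgue_on U)"
  shows "(AE \<omega> in P. (\<lambda>l. \<Sum>k=1..m l. (d l k \<omega>)\<^sup>2) sums (L2_norm U (w \<omega>))\<^sup>2) \<and>
         (\<forall>l. \<forall>k\<in>{1..m l}. integrable P (\<lambda>\<omega>. (d l k \<omega>)\<^sup>2)) \<and>
         (\<lambda>l. \<Sum>k=1..m l. (\<integral>\<omega>. (d l k \<omega>)\<^sup>2 \<partial>P)) sums (bochner_L2_norm P U w)\<^sup>2"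
proof -
  note ml = assms(8) and onb = assms(11) and w = assms(12)
  have psi: "\<psi> l k \<in> L2_fun U" "L2_inner U (\<psi> l k) (\<psi> l k) = 1" "\<psi> l k \<in> W l"
    if "k \<in> {1..m l}" for l k
  proof -
    have *: "\<psi> l j \<in> L2_fun U" if "j \<in> {1..m l}" for j
      using onb[of l] that by (auto simp: L2_orthonormal_basis_def L2_orthonormal_def)
    show "\<psi> l k \<in> L2_fun U"
      using that by (rule *)
    show "L2_inner U (\<psi> l k) (\<psi> l k) = 1"
      using onb[of l] that unfolding L2_orthonormal_basis_def L2_orthonormal_def by simp
    show "\<psi> l k \<in> W l"
      using L2_span_generator[of "m l" "\<psi> l" U k] * that onb[of l]
      by (simp add: L2_orthonormal_basis_def)
  qed
  \<comment> \<open>For fixed \<open>\<omega>\<close> the factors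
    \<open>sqrt (lam k) * Y k \<omega>\<close> are scalars, so every realization lies in the span of
    the \<open>\<phi> k\<close>.\<close>
  have KL: "KL_truncation M lam \<phi> Y \<omega> \<in> V 0" for \<omega>
  proof -
    have "\<phi> k \<in> L2_fun U" if "k \<in> {1..M}" for k
      using assms(7) that by (simp add: KL_expansion_def L2_orthonormal_def)
    then have "(\<lambda>x. \<Sum>k=1..M. (sqrt (lam k) * Y k \<omega>) * \<phi> k x) \<in> V 0"
      unfolding assms(9) by (rule L2_span_sum)
    also have "(\<lambda>x. \<Sum>k=1..M. (sqrt (lam k) * Y k \<omega>) * \<phi> k x) = KL_truncation M lam \<phi> Y \<omega>"
      by (simp add: KL_truncation_def fun_eq_iff mult_ac)
    finally show ?thesis .
  qed
  \<comment> \<open>Nestedness places \<open>f\<close> in \<open>V l\<close>, which is orthogonal to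
    \<open>W l\<close>.\<close>
  have V_orth: "L2_inner U f (\<psi> l k) = 0" if "f \<in> V 0" "k \<in> {1..m l}" for f l k
  proof -
    have "f \<in> V l"
      using multilevel_decomposition_mono[OF ml, of 0 l] that by auto
    then show ?thesis
      using ml psi(3)[OF that(2)]
      unfolding multilevel_decomposition_def L2_orthogonal_sum_def by blast
  qed
  have V0: "V 0 \<subseteq> L2_fun U"
    using ml by (simp add: multilevel_decomposition_def L2_subspace_def)
  have w_L2: "AE \<omega> in P. w \<omega> \<in> L2_fun U"
    using w by (simp add: bochner_L2_def L2_strongly_measurable_def)
  have w_int: "integrable P (\<lambda>\<omega>. (L2_norm U (w \<omega>))\<^sup>2)"
    using w by (simp add: bochner_L2_def)
  \<comment> \<open>The exceptional null set stems from \<open>u\<close> and \<open>w\<close> alone,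
    so one set serves all \<open>l\<close> and \<open>k\<close> and the quantifiers may stand
    inside.\<close>
  have d_eq: "AE \<omega> in P. \<forall>l. \<forall>k\<in>{1..m l}. d l k \<omega> = L2_inner U (w \<omega>) (\<psi> l k)"
    using w_L2 assms(14)
  proof eventually_elim
    case (elim \<omega>)
    show ?case
    proof (intro allI ballI)
      fix l k assume k: "k \<in> {1..m l}"
      have KL': "KL_truncation M lam \<phi> Y \<omega> \<in> L2_fun U"
        using KL V0 by blast
      have "d l k \<omega> = L2_inner U (u \<omega>) (\<psi> l k)"
        by (simp add: assms(15) L2_inner_def)
      also have "\<dots> = L2_inner U (\<lambda>x. KL_truncation M lam \<phi> Y \<omega> x + w \<omega> x) (\<psi> l k)"
        using elim KL' psi(1)[OF k] \<open>open U\<close> by (intro L2_inner_cong_AE L2_fun_add) auto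
      also have "\<dots> = L2_inner U (w \<omega>) (\<psi> l k)"
        using elim KL' psi(1)[OF k] V_orth[OF KL k] by (simp add: L2_inner_add_left)
      finally show "d l k \<omega> = L2_inner U (w \<omega>) (\<psi> l k)" .
    qed
  qed
  have parseval: "AE \<omega> in P. (\<lambda>l. \<Sum>k=1..m l. (d l k \<omega>)\<^sup>2) sums (L2_norm U (w \<omega>))\<^sup>2"
    using d_eq w_L2 assms(13)
  proof eventually_elim
    case (elim \<omega>)
    have "(\<lambda>l. \<Sum>k=1..m l. (L2_inner U (w \<omega>) (\<psi> l k))\<^sup>2) sums (L2_norm U (w \<omega>))\<^sup>2"
      using elim by (intro multilevel_parseval[OF \<open>open U\<close> ml onb]) auto
    then show ?case
      using elim(1) by simp
  qed
  \<comment> \<open>On a null set \<open>u\<close> is arbitrary, so measurability is transferred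
    from the coefficients of \<open>w\<close> through completeness of \<open>P\<close>.\<close>
  have d_meas: "d l k \<in> borel_measurable P" if k: "k \<in> {1..m l}" for l k
  proof -
    have "(\<lambda>\<omega>. L2_inner U (w \<omega>) (\<psi> l k)) \<in> borel_measurable P"
      using w psi[OF k] assms(2)
      by (intro L2_strongly_measurable_inner_unit) (auto simp: bochner_L2_def)
    moreover have "AE \<omega> in P. L2_inner U (w \<omega>) (\<psi> l k) = d l k \<omega>"
      using d_eq k by (auto elim!: eventually_mono)
    ultimately show ?thesis
      by (rule complete_measure.measurable_cong_AE_complete[OF assms(2)]) simp
  qed
  \<comment> \<open>Cauchy-Schwarz with the unit vector \<open>\<psi> l k\<close> bounds a single
    squared coefficient by the squared norm of \<open>w \<omega>\<close>.\<close>
  have d_int: "integrable P (\<lambda>\<omega>. (d l k \<omega>)\<^sup>2)" if k: "k \<in> {1..m l}" for l k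
  proof (rule Bochner_Integration.integrable_bound[OF w_int])
    show "(\<lambda>\<omega>. (d l k \<omega>)\<^sup>2) \<in> borel_measurable P"
      using d_meas[OF k] by simp
    show "AE \<omega> in P. norm ((d l k \<omega>)\<^sup>2) \<le> norm ((L2_norm U (w \<omega>))\<^sup>2)"
      using d_eq w_L2
    proof eventually_elim
      case (elim \<omega>)
      then show ?case
        using power_mono[OF L2_inner_le_norm_unit[OF elim(2) psi(1,2)[OF k]] abs_ge_zero, of 2] k
        by simp
    qed
  qed
  have "(\<lambda>N. \<integral>\<omega>. (\<Sum>l<N. \<Sum>k=1..m l. (d l k \<omega>)\<^sup>2) \<partial>P) \<longlonglongrightarrow> (\<integral>\<omega>. (L2_norm U (w \<omega>))\<^sup>2 \<partial>P)"
  proof (rule integral_dominated_convergence)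
    show "(\<lambda>\<omega>. (L2_norm U (w \<omega>))\<^sup>2) \<in> borel_measurable P" "integrable P (\<lambda>\<omega>. (L2_norm U (w \<omega>))\<^sup>2)"
      using w_int by auto
    show "(\<lambda>\<omega>. \<Sum>l<N. \<Sum>k=1..m l. (d l k \<omega>)\<^sup>2) \<in> borel_measurable P" for N
      using d_meas by (intro borel_measurable_sum borel_measurable_power)
    show "AE \<omega> in P. (\<lambda>N. \<Sum>l<N. \<Sum>k=1..m l. (d l k \<omega>)\<^sup>2) \<longlonglongrightarrow> (L2_norm U (w \<omega>))\<^sup>2"
      using parseval by (simp add: sums_def)
    show "AE \<omega> in P. norm (\<Sum>l<N. \<Sum>k=1..m l. (d l k \<omega>)\<^sup>2) \<le> (L2_norm U (w \<omega>))\<^sup>2" for N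
      using parseval
    proof eventually_elim
      case (elim \<omega>)
      \<comment> \<open>The terms are nonnegative, so partial sums stay below the full sum, which
        Parseval identifies with the dominating function.\<close>
      have "(\<Sum>l<N. \<Sum>k=1..m l. (d l k \<omega>)\<^sup>2) \<le> (\<Sum>l. \<Sum>k=1..m l. (d l k \<omega>)\<^sup>2)"
        using elim by (intro sum_le_suminf) (auto simp: sums_iff intro: sum_nonneg)
      then show ?case
        using elim by (simp add: sums_iff sum_nonneg)
    qed
  qed
  \<comment> \<open>Only finite sums are exchanged with the expectation here; the passage to
    infinitely many levels is the limit just obtained.\<close>
  moreover have "(\<integral>\<omega>. (\<Sum>l<N. \<Sum>k=1..m l. (d l k \<omega>)\<^sup>2) \<partial>P) =
      (\<Sum>l<N. \<Sum>k=1..m l. (\<integral>\<omega>. (d l k \<omega>)\<^sup>2 \<partial>P))" for N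
  proof (subst Bochner_Integration.integral_sum)
    show "integrable P (\<lambda>\<omega>. \<Sum>k=1..m l. (d l k \<omega>)\<^sup>2)" for l
      using d_int by (intro Bochner_Integration.integrable_sum)
    show "(\<Sum>l<N. \<integral>\<omega>. (\<Sum>k=1..m l. (d l k \<omega>)\<^sup>2) \<partial>P) =
        (\<Sum>l<N. \<Sum>k=1..m l. (\<integral>\<omega>. (d l k \<omega>)\<^sup>2 \<partial>P))"
      using d_int by (intro sum.cong refl Bochner_Integration.integral_sum)
  qed
  moreover have "(bochner_L2_norm P U w)\<^sup>2 = (\<integral>\<omega>. (L2_norm U (w \<omega>))\<^sup>2 \<partial>P)"
    by (simp add: bochner_L2_norm_def bochner_L2_inner_def L2_norm_squared L2_inner_self_nonneg)
  ultimately have "(\<lambda>l. \<Sum>k=1..m l. (\<integral>\<omega>. (d l k \<omega>)\<^sup>2 \<partial>P)) sums (bochner_L2_norm P U w)\<^sup>2"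
    by (simp add: sums_def)
  then show ?thesis
    using parseval d_int by blast
qed

end
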